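(* Let $X$ be an almost surely bounded, non-degenerate real random variable with mean $\mu=\mathbb{E}[X]$, let $\mathcal{K}(\lambda)=\ln\mathbb{E}[\exp(\lambda(X-\mu))]$ for $\lambda\in\mathbb{R}$, and let $h(\lambda)=\frac{2}{\lambda^2}\mathcal{K}(\lambda)$ for $\lambda\neq0$, $h(0)=\mathbb{V}[X]$. Then the optimal proxy variance of $X$ is given by $$\sigma_{\mathrm{opt}}^2=\max_{\lambda\in\mathbb{R}} h(\lambda)=\max_{\lambda\in\mathbb{R}}\frac{2}{\lambda^2}\mathcal{K}(\lambda),$$ where $\frac{2}{\lambda^2}\mathcal{K}(\lambda)$ is understood as its continuous extension $h(0)=\mathbb{V}[X]$ at $\lambda=0$.
   Context: A random variable $X$ with finite mean $\mu$ is $\sigma^2$-sub-Gaussian, with proxy variance $\sigma^2>0$, if $\mathbb{E}[\exp(\lambda(X-\mu))]\le \exp(\lambda^2\sigma^2/2)$ for all $\lambda\in\mathbb{R}$. The smallest such $\sigma^2$ is the optimal proxy variance $\sigma_{\mathrm{opt}}^2=\sigma_{\mathrm{opt}}^2(X)$. $\mathbb{V}[X]$ denotes the variance. Non-degenerate means not almost surely constant. *)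

theory Defs
  imports "HOL-Probability.Probability"
begin

(* The integrability condition on the exponentials is part of the inequality
   E[exp(l (X - mu))] <= exp(l^2 s / 2): the expectation is meant in [0, infinity], whereas the
   Bochner integral of a non-integrable function is 0. *)
definition sub_gaussian :: "'a measure \<Rightarrow> ('a \<Rightarrow> real) \<Rightarrow> real \<Rightarrow> bool" where
  "sub_gaussian M X s \<longleftrightarrow>
     s > 0 \<and> integrable M X \<and>
     (\<forall>l::real.
        integrable M (\<lambda>x. exp (l * (X x - prob_space.expectation M X))) \<and>
        prob_space.expectation M (\<lambda>x. exp (l * (X x - prob_space.expectation M X)))
          \<le> exp (l\<^sup>2 * s / 2))"

(* Meaningful only when a smallest proxy variance exists; otherwise LEAST is an unspecified real. *)
definition optimal_proxy_variance :: "'a measure \<Rightarrow> ('a \<Rightarrow> real) \<Rightarrow> real" where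
  "optimal_proxy_variance M X = (LEAST s. sub_gaussian M X s)"

definition centered_cgf :: "'a measure \<Rightarrow> ('a \<Rightarrow> real) \<Rightarrow> real \<Rightarrow> real" where
  "centered_cgf M X l =
     ln (prob_space.expectation M (\<lambda>x. exp (l * (X x - prob_space.expectation M X))))"

definition scaled_cgf :: "'a measure \<Rightarrow> ('a \<Rightarrow> real) \<Rightarrow> real \<Rightarrow> real" where
  "scaled_cgf M X l =
     (if l = 0 then prob_space.variance M X else 2 / l\<^sup>2 * centered_cgf M X l)"

(* Max from the library is restricted to finite sets; this says that m is an attained maximum. *)
definition is_maximum :: "('b \<Rightarrow> real) \<Rightarrow> real \<Rightarrow> bool" where
  "is_maximum f m \<longleftrightarrow> (\<exists>l. f l = m) \<and> (\<forall>l. f l \<le> m)"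

end

theory Submission
  imports Defs
begin

text \<open>
  Write \<open>Y\<close> for the centred variable and \<open>\<phi> l\<close> for the expectation of \<open>exp (l * Y)\<close>. Taking
  logarithms in \<open>\<phi> l \<le> exp (l\<^sup>2 * s / 2)\<close> shows that \<open>s > 0\<close> is a proxy variance exactly when it is
  an upper bound of \<open>h l = 2 / l\<^sup>2 * ln (\<phi> l)\<close> over \<open>l \<noteq> 0\<close>. The smallest proxy variance is
  therefore the supremum of \<open>h\<close>, and it remains to see that this supremum is positive and attained.

  Three properties of \<open>h\<close> give this. It extends continuously by the variance at \<open>0\<close>, because
  \<open>\<phi> l = 1 + l\<^sup>2 V / 2 + O(l\<^sup>3)\<close> when \<open>Y\<close> is bounded (\<open>tendsto_scaled_log_mgf\<close>). It is continuous
  elsewhere, because \<open>\<phi>\<close> is convex and positive. It decays at infinity, because \<open>\<phi> l \<le> exp (\<bar>l\<bar> B)\<close>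
  yields \<open>h l \<le> 2 B / \<bar>l\<bar>\<close>. Since \<open>h 0\<close> is the variance and non-degeneracy makes it positive, \<open>h\<close>
  falls below \<open>h 0\<close> outside a compact interval and attains its maximum inside
  (\<open>decaying_attains_max\<close>). The continuity at \<open>0\<close> is also what makes every proxy variance dominate
  \<open>h 0\<close>: at \<open>l = 0\<close> the defining inequality reads \<open>1 \<le> 1\<close> whatever \<open>s\<close> is.
\<close>

section \<open>Two facts about real functions\<close>

text \<open>Outside the interval of radius \<open>\<bar>C\<bar> / f 0\<close> the function lies below \<open>f 0\<close>, so that a maximum over
  this compact interval, which contains \<open>0\<close>, is a global one.\<close>

lemma decaying_attains_max:
  fixes f :: "real \<Rightarrow> real"
  assumes cont: "continuous_on UNIV f"
    and pos: "f 0 > 0"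
    and decay: "\<And>x. x \<noteq> 0 \<Longrightarrow> f x \<le> C / \<bar>x\<bar>"
  obtains x where "\<And>y. f y \<le> f x"
proof -
  define R where "R = \<bar>C\<bar> / f 0"
  have "R \<ge> 0" using pos by (simp add: R_def)
  then have "\<exists>x\<in>{-R..R}. \<forall>y\<in>{-R..R}. f y \<le> f x"
    by (intro continuous_attains_sup continuous_on_subset[OF cont]) auto
  then obtain x where x: "\<And>y. y \<in> {-R..R} \<Longrightarrow> f y \<le> f x" by blast
  have "f y \<le> f x" for y
  proof (cases "\<bar>y\<bar> \<le> R")
    case True
    then show ?thesis by (intro x) (simp add: abs_le_iff)
  next
    case False
    with \<open>R \<ge> 0\<close> have y: "\<bar>y\<bar> > 0" "\<bar>C\<bar> / f 0 < \<bar>y\<bar>" by (auto simp: R_def)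
    have "C \<le> f 0 * \<bar>y\<bar>" using y(2) pos by (simp add: pos_divide_less_eq mult.commute)
    then have "C / \<bar>y\<bar> \<le> f 0" using y(1) by (simp add: pos_divide_le_eq)
    moreover have "f 0 \<le> f x" using x[of 0] \<open>R \<ge> 0\<close> by simp
    ultimately show ?thesis using decay[of y] y(1) by simp
  qed
  then show ?thesis by (rule that)
qed

lemma exp_taylor2_bound:
  fixes t c :: real
  assumes "\<bar>t\<bar> \<le> c"
  shows "\<bar>exp t - (1 + t + t\<^sup>2 / 2)\<bar> \<le> exp c * c ^ 3"
proof -
  obtain u where u: "\<bar>u\<bar> \<le> \<bar>t\<bar>" "exp t = (\<Sum>m<3. t ^ m / fact m) + exp u / fact 3 * t ^ 3"
    using Maclaurin_exp_le[of t 3] by blast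
  have "exp t - (1 + t + t\<^sup>2 / 2) = exp u / 6 * t ^ 3"
    using u(2) by (simp add: eval_nat_numeral)
  also have "\<bar>\<dots>\<bar> = exp u / 6 * \<bar>t\<bar> ^ 3" by (simp add: abs_mult power_abs)
  also have "\<dots> \<le> exp c * c ^ 3"
  proof (intro mult_mono power_mono)
    have "exp u / 6 \<le> exp u" by simp
    also have "exp u \<le> exp c" using u(1) assms by simp
    finally show "exp u / 6 \<le> exp c" .
  qed (use assms in simp_all)
  finally show ?thesis .
qed

section \<open>The moment generating function of a bounded centred variable\<close>

locale bounded_centered = prob_space M for M :: "'a measure" +
  fixes Y :: "'a \<Rightarrow> real" and B :: real
  assumes measurable_Y [measurable]: "Y \<in> borel_measurable M"
    and AE_bound: "AE x in M. \<bar>Y x\<bar> \<le> B"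
    and mean_zero: "expectation Y = 0"
begin

definition mgf :: "real \<Rightarrow> real" where
  "mgf l = expectation (\<lambda>x. exp (l * Y x))"

lemma AE_abs_mult_le: "AE x in M. \<bar>l * Y x\<bar> \<le> \<bar>l\<bar> * B"
  using AE_bound by eventually_elim (simp add: abs_mult mult_left_mono)

lemma integrable_exp: "integrable M (\<lambda>x. exp (l * Y x))"
proof (rule integrable_const_bound[where B = "exp (\<bar>l\<bar> * B)"])
  show "AE x in M. norm (exp (l * Y x)) \<le> exp (\<bar>l\<bar> * B)"
    using AE_abs_mult_le[of l] by eventually_elim auto
qed measurable

lemma integrable_Y: "integrable M Y"
  by (rule integrable_const_bound[where B = B]) (use AE_bound in auto)

lemma integrable_Y_squared: "integrable M (\<lambda>x. (Y x)\<^sup>2)"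
proof (rule integrable_const_bound[where B = "B\<^sup>2"])
  show "AE x in M. norm ((Y x)\<^sup>2) \<le> B\<^sup>2"
    using AE_bound by eventually_elim (simp add: abs_le_square_iff[symmetric])
qed measurable

lemma mgf_pos: "mgf l > 0"
proof -
  have "exp (- (\<bar>l\<bar> * B)) \<le> mgf l"
    unfolding mgf_def
  proof (rule integral_ge_const[OF integrable_exp])
    show "AE x in M. exp (- (\<bar>l\<bar> * B)) \<le> exp (l * Y x)"
      using AE_abs_mult_le[of l] by eventually_elim auto
  qed
  then show ?thesis by (meson exp_gt_zero less_le_trans)
qed

lemma mgf_le: "mgf l \<le> exp (\<bar>l\<bar> * B)"
  unfolding mgf_def
proof (rule integral_le_const[OF integrable_exp])
  show "AE x in M. exp (l * Y x) \<le> exp (\<bar>l\<bar> * B)"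
    using AE_abs_mult_le[of l] by eventually_elim auto
qed

text \<open>A convex function on the whole line is continuous, and \<open>mgf\<close> is a mixture of the convex
  functions \<open>\<lambda>l. exp (l * y)\<close>.\<close>

lemma continuous_on_mgf: "continuous_on UNIV mgf"
proof (rule convex_on_continuous[OF open_UNIV], rule convex_onI)
  fix t a b :: real
  assume t: "0 < t" "t < 1"
  have "mgf ((1 - t) * a + t * b)
      \<le> expectation (\<lambda>x. (1 - t) * exp (a * Y x) + t * exp (b * Y x))"
    unfolding mgf_def
  proof (rule integral_mono)
    fix x
    have "exp ((1 - t) *\<^sub>R (a * Y x) + t *\<^sub>R (b * Y x)) \<le> (1 - t) * exp (a * Y x) + t * exp (b * Y x)"
      using t by (intro convex_onD[OF exp_convex]) auto
    then show "exp (((1 - t) * a + t * b) * Y x) \<le> (1 - t) * exp (a * Y x) + t * exp (b * Y x)"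
      by (simp add: algebra_simps)
  qed (auto intro!: integrable_exp Bochner_Integration.integrable_add integrable_mult_right)
  also have "\<dots> = (1 - t) * mgf a + t * mgf b"
    by (simp add: mgf_def integrable_exp)
  finally show "mgf ((1 - t) *\<^sub>R a + t *\<^sub>R b) \<le> (1 - t) * mgf a + t * mgf b"
    by simp
qed auto

text \<open>Integrating the Taylor estimate of the exponential: the linear term vanishes since \<open>Y\<close> is
  centred.\<close>

lemma mgf_taylor2:
  "\<bar>mgf l - 1 - l\<^sup>2 * expectation (\<lambda>x. (Y x)\<^sup>2) / 2\<bar> \<le> exp (\<bar>l\<bar> * B) * (\<bar>l\<bar> * B) ^ 3"
proof -
  let ?r = "\<lambda>x. exp (l * Y x) - (1 + l * Y x + (l * Y x)\<^sup>2 / 2)"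
  have int2: "integrable M (\<lambda>x. (l * Y x)\<^sup>2 / 2)"
    using integrable_Y_squared by (simp add: power_mult_distrib)
  have intr: "integrable M ?r"
    using integrable_exp integrable_Y int2 by auto
  have AE: "AE x in M. \<bar>?r x\<bar> \<le> exp (\<bar>l\<bar> * B) * (\<bar>l\<bar> * B) ^ 3"
    using AE_abs_mult_le[of l] by eventually_elim (rule exp_taylor2_bound)
  have "expectation ?r = mgf l - (1 + l * expectation Y + expectation (\<lambda>x. (l * Y x)\<^sup>2 / 2))"
    unfolding mgf_def using integrable_exp integrable_Y int2 by (simp add: prob_space)
  also have "\<dots> = mgf l - 1 - l\<^sup>2 * expectation (\<lambda>x. (Y x)\<^sup>2) / 2"
    by (simp add: mean_zero power_mult_distrib)
  finally have eq: "mgf l - 1 - l\<^sup>2 * expectation (\<lambda>x. (Y x)\<^sup>2) / 2 = expectation ?r" ..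
  have "\<bar>expectation ?r\<bar> \<le> expectation (\<lambda>x. \<bar>?r x\<bar>)"
    by (rule integral_abs_bound)
  also have "\<dots> \<le> exp (\<bar>l\<bar> * B) * (\<bar>l\<bar> * B) ^ 3"
    using intr AE by (intro integral_le_const integrable_abs)
  finally show ?thesis by (simp only: eq)
qed

section \<open>The scaled logarithm of the moment generating function\<close>

text \<open>The bounds \<open>(u - 1) / u \<le> ln u \<le> u - 1\<close> at \<open>u = mgf l\<close> reduce the limit to that of
  \<open>2 / l\<^sup>2 * (mgf l - 1)\<close>, without dividing by \<open>mgf l - 1\<close>.\<close>

lemma tendsto_scaled_log_mgf:
  "((\<lambda>l. 2 / l\<^sup>2 * ln (mgf l)) \<longlongrightarrow> expectation (\<lambda>x. (Y x)\<^sup>2)) (at 0)"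
proof -
  let ?V = "expectation (\<lambda>x. (Y x)\<^sup>2)"
  let ?q = "\<lambda>l. 2 / l\<^sup>2 * (mgf l - 1)"
  have nz: "eventually (\<lambda>l::real. l \<noteq> 0) (at 0)"
    by (simp add: eventually_at_filter)
  have diff: "\<bar>?q l - ?V\<bar> \<le> 2 * exp (\<bar>l\<bar> * B) * \<bar>l\<bar> * B ^ 3" if "l \<noteq> 0" for l
  proof -
    have "?q l - ?V = 2 / l\<^sup>2 * (mgf l - 1 - l\<^sup>2 * ?V / 2)"
      using that by (simp add: field_simps)
    also have "\<bar>\<dots>\<bar> = 2 / l\<^sup>2 * \<bar>mgf l - 1 - l\<^sup>2 * ?V / 2\<bar>"
      unfolding abs_mult by simp
    also have "\<dots> \<le> 2 / l\<^sup>2 * (exp (\<bar>l\<bar> * B) * (\<bar>l\<bar> * B) ^ 3)"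
      by (intro mult_left_mono mgf_taylor2) simp
    also have "\<dots> = 2 / \<bar>l\<bar>\<^sup>2 * (exp (\<bar>l\<bar> * B) * (\<bar>l\<bar> * B) ^ 3)" by simp
    also have "\<dots> = 2 * exp (\<bar>l\<bar> * B) * \<bar>l\<bar> * B ^ 3"
      using that by (simp add: power_mult_distrib power2_eq_square power3_eq_cube del: abs_mult_self_eq)
    finally show ?thesis .
  qed
  have "((\<lambda>l. 2 * exp (\<bar>l\<bar> * B) * \<bar>l\<bar> * B ^ 3) \<longlongrightarrow> 2 * exp (\<bar>0\<bar> * B) * \<bar>0\<bar> * B ^ 3) (at 0)"
    by (intro tendsto_intros)
  then have "((\<lambda>l. 2 * exp (\<bar>l\<bar> * B) * \<bar>l\<bar> * B ^ 3) \<longlongrightarrow> 0) (at 0)" by simp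
  then have "((\<lambda>l. ?q l - ?V) \<longlongrightarrow> 0) (at 0)"
    by (rule Lim_null_comparison[rotated]) (use nz diff in \<open>auto elim: eventually_mono\<close>)
  then have q: "(?q \<longlongrightarrow> ?V) (at 0)" by (simp add: LIM_zero_iff)
  have "(mgf \<longlongrightarrow> mgf 0) (at 0)"
    using continuous_on_mgf by (simp add: continuous_on_def)
  then have "(mgf \<longlongrightarrow> 1) (at 0)" by (simp add: mgf_def prob_space)
  from tendsto_divide[OF q this] have q': "((\<lambda>l. ?q l / mgf l) \<longlongrightarrow> ?V) (at 0)" by simp
  show ?thesis
  proof (rule tendsto_sandwich[OF always_eventually always_eventually q' q]; intro allI)
    fix l
    show "2 / l\<^sup>2 * ln (mgf l) \<le> ?q l"
      by (intro mult_left_mono ln_le_minus_one mgf_pos) simp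
    have "- ln (mgf l) \<le> 1 / mgf l - 1"
      using ln_le_minus_one[of "1 / mgf l"] mgf_pos[of l] by (simp add: ln_div)
    then have "(mgf l - 1) / mgf l \<le> ln (mgf l)"
      using mgf_pos[of l] by (simp add: diff_divide_distrib)
    then have "2 / l\<^sup>2 * ((mgf l - 1) / mgf l) \<le> 2 / l\<^sup>2 * ln (mgf l)"
      by (rule mult_left_mono) simp
    then show "?q l / mgf l \<le> 2 / l\<^sup>2 * ln (mgf l)" by simp
  qed
qed

definition scaled_log_mgf :: "real \<Rightarrow> real" where
  "scaled_log_mgf l = (if l = 0 then expectation (\<lambda>x. (Y x)\<^sup>2) else 2 / l\<^sup>2 * ln (mgf l))"

lemma continuous_on_scaled_log_mgf: "continuous_on UNIV scaled_log_mgf"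
proof -
  have "(scaled_log_mgf \<longlongrightarrow> scaled_log_mgf l) (at l)" for l
  proof (cases "l = 0")
    case True
    have "(scaled_log_mgf \<longlongrightarrow> expectation (\<lambda>x. (Y x)\<^sup>2)) (at 0)"
      by (rule Lim_transform_eventually[OF tendsto_scaled_log_mgf])
        (simp add: scaled_log_mgf_def eventually_at_filter)
    then show ?thesis using True by (simp add: scaled_log_mgf_def)
  next
    case False
    have "(mgf \<longlongrightarrow> mgf l) (at l)"
      using continuous_on_mgf by (simp add: continuous_on_def)
    then have "((\<lambda>l. 2 / l\<^sup>2 * ln (mgf l)) \<longlongrightarrow> 2 / l\<^sup>2 * ln (mgf l)) (at l)"
      using False mgf_pos[of l] by (intro tendsto_intros) auto
    moreover have "eventually (\<lambda>k. k \<noteq> 0) (at l)"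
      using eventually_neq_at_within[of 0 l UNIV] .
    then have "eventually (\<lambda>k. 2 / k\<^sup>2 * ln (mgf k) = scaled_log_mgf k) (at l)"
      by eventually_elim (simp add: scaled_log_mgf_def)
    ultimately show ?thesis
      using False by (auto simp: scaled_log_mgf_def intro: Lim_transform_eventually)
  qed
  then show ?thesis by (simp add: continuous_on_def)
qed

lemma scaled_log_mgf_decay:
  assumes "l \<noteq> 0"
  shows "scaled_log_mgf l \<le> 2 * B / \<bar>l\<bar>"
proof -
  have "ln (mgf l) \<le> \<bar>l\<bar> * B"
    using mgf_le[of l] mgf_pos[of l] by (metis exp_le_cancel_iff exp_ln)
  then have "2 / l\<^sup>2 * ln (mgf l) \<le> 2 / l\<^sup>2 * (\<bar>l\<bar> * B)"
    by (rule mult_left_mono) simp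
  also have "\<dots> = 2 / \<bar>l\<bar>\<^sup>2 * (\<bar>l\<bar> * B)" by simp
  also have "\<dots> = 2 * B / \<bar>l\<bar>"
    using assms by (simp add: power2_eq_square del: abs_mult_self_eq)
  finally show ?thesis using assms by (simp add: scaled_log_mgf_def)
qed

text \<open>At \<open>l = 0\<close> the exponential inequality carries no information, and the bound on
  \<open>scaled_log_mgf 0\<close> comes from the neighbouring points by continuity.\<close>

lemma mgf_le_gaussian_iff:
  "(\<forall>l. mgf l \<le> exp (l\<^sup>2 * s / 2)) \<longleftrightarrow> (\<forall>l. scaled_log_mgf l \<le> s)"
proof -
  have iff: "mgf l \<le> exp (l\<^sup>2 * s / 2) \<longleftrightarrow> scaled_log_mgf l \<le> s" if "l \<noteq> 0" for l
  proof -
    have "mgf l \<le> exp (l\<^sup>2 * s / 2) \<longleftrightarrow> ln (mgf l) \<le> l\<^sup>2 * s / 2"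
      using mgf_pos[of l] by (metis exp_le_cancel_iff exp_ln)
    also have "\<dots> \<longleftrightarrow> scaled_log_mgf l \<le> s"
      using that by (simp add: scaled_log_mgf_def field_simps)
    finally show ?thesis .
  qed
  have "scaled_log_mgf 0 \<le> s" if "\<And>l. l \<noteq> 0 \<Longrightarrow> scaled_log_mgf l \<le> s"
  proof (rule tendsto_upperbound)
    show "(scaled_log_mgf \<longlongrightarrow> scaled_log_mgf 0) (at 0)"
      using continuous_on_scaled_log_mgf by (simp add: continuous_on_def)
    show "eventually (\<lambda>l. scaled_log_mgf l \<le> s) (at 0)"
      using that by (simp add: eventually_at_filter)
  qed simp
  moreover have "mgf 0 = 1" by (simp add: mgf_def prob_space)
  ultimately have zero: "scaled_log_mgf 0 \<le> s" "mgf 0 \<le> exp (0\<^sup>2 * s / 2)"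
    if "\<And>l. l \<noteq> 0 \<Longrightarrow> scaled_log_mgf l \<le> s"
    using that by auto
  show ?thesis
  proof (intro iffI allI)
    fix l
    assume "\<forall>l. mgf l \<le> exp (l\<^sup>2 * s / 2)"
    then show "scaled_log_mgf l \<le> s"
      using iff zero(1) by (cases "l = 0") blast+
  next
    fix l
    assume "\<forall>l. scaled_log_mgf l \<le> s"
    then show "mgf l \<le> exp (l\<^sup>2 * s / 2)"
      using iff zero(2) by (cases "l = 0") blast+
  qed
qed

lemma second_moment_pos:
  assumes "\<not> (AE x in M. Y x = 0)"
  shows "expectation (\<lambda>x. (Y x)\<^sup>2) > 0"
proof -
  have "expectation (\<lambda>x. (Y x)\<^sup>2) \<noteq> 0"
    using assms integral_nonneg_eq_0_iff_AE[OF integrable_Y_squared] by simp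
  then show ?thesis by (simp add: order_less_le)
qed

end

section \<open>The optimal proxy variance\<close>

theorem proposition2p1:
  fixes M :: "'a measure" and X :: "'a \<Rightarrow> real"
  assumes "prob_space M"
    and "X \<in> borel_measurable M"
    and bounded: "\<exists>B::real. AE x in M. \<bar>X x\<bar> \<le> B"
    and nondegenerate: "\<not> (\<exists>c::real. AE x in M. X x = c)"
  shows "sub_gaussian M X (optimal_proxy_variance M X)
    \<and> (\<forall>s. sub_gaussian M X s \<longrightarrow> optimal_proxy_variance M X \<le> s)
    \<and> is_maximum (scaled_cgf M X) (optimal_proxy_variance M X)
    \<and> ((\<lambda>l. 2 / l\<^sup>2 * centered_cgf M X l) \<longlongrightarrow> scaled_cgf M X 0) (at 0)"
proof -
  interpret prob_space M by fact
  have [measurable]: "X \<in> borel_measurable M" by fact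
  obtain B where B: "AE x in M. \<bar>X x\<bar> \<le> B" using bounded by blast
  have intX: "integrable M X"
    by (rule integrable_const_bound[where B = B]) (use B in auto)
  let ?Y = "\<lambda>x. X x - expectation X"
  interpret Y: bounded_centered M ?Y "B + \<bar>expectation X\<bar>"
  proof
    show "AE x in M. \<bar>?Y x\<bar> \<le> B + \<bar>expectation X\<bar>"
      using B by eventually_elim auto
    show "expectation ?Y = 0" using intX by (simp add: prob_space)
  qed measurable

  have cgf: "centered_cgf M X l = ln (Y.mgf l)" for l
    by (simp add: centered_cgf_def Y.mgf_def)
  have scaled: "scaled_cgf M X = Y.scaled_log_mgf"
    by (simp add: fun_eq_iff scaled_cgf_def Y.scaled_log_mgf_def cgf)
  have sub_gaussian: "sub_gaussian M X s \<longleftrightarrow> s > 0 \<and> (\<forall>l. scaled_cgf M X l \<le> s)" for s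
    unfolding sub_gaussian_def scaled Y.mgf_le_gaussian_iff[symmetric]
    using intX Y.integrable_exp by (simp add: Y.mgf_def)

  have pos: "scaled_cgf M X 0 > 0"
    using Y.second_moment_pos nondegenerate by (auto simp: scaled Y.scaled_log_mgf_def)
  obtain k where k: "\<And>l. scaled_cgf M X l \<le> scaled_cgf M X k"
    using decaying_attains_max[OF Y.continuous_on_scaled_log_mgf pos[unfolded scaled]
        Y.scaled_log_mgf_decay, folded scaled] by blast
  have k_pos: "scaled_cgf M X k > 0" using pos k[of 0] by (rule less_le_trans)
  have opt: "optimal_proxy_variance M X = scaled_cgf M X k"
    unfolding optimal_proxy_variance_def
    using k_pos k by (intro Least_equality) (auto simp: sub_gaussian)
  show ?thesis
  proof (intro conjI)
    show "sub_gaussian M X (optimal_proxy_variance M X)"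
      using k_pos k by (simp add: opt sub_gaussian)
    show "\<forall>s. sub_gaussian M X s \<longrightarrow> optimal_proxy_variance M X \<le> s"
      by (auto simp: opt sub_gaussian)
    show "is_maximum (scaled_cgf M X) (optimal_proxy_variance M X)"
      using k by (auto simp: is_maximum_def opt)
    show "((\<lambda>l. 2 / l\<^sup>2 * centered_cgf M X l) \<longlongrightarrow> scaled_cgf M X 0) (at 0)"
      using Y.tendsto_scaled_log_mgf by (simp add: cgf scaled Y.scaled_log_mgf_def)
  qed
qed

end
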